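(* Let $q,a,b,z$ be complex numbers with $|q|<1$ and $|b/a|<|z|<1$. Then \[ \sum_{n=-\infty}^{\infty}\frac{(a)_n}{(b)_n}z^n = -1 +\frac{(b/a)_\infty(az)_\infty}{(b)_\infty(z)_\infty}\sum_{n=0}^{\infty}\frac{(aqz/b)_n(a)_n}{(q)_n(az)_n}(b/a)^n +\frac{(b/a)_\infty(q/az)_\infty}{(q/a)_\infty(b/az)_\infty}\sum_{n=0}^{\infty}\frac{(q/z)_n(q/b)_n}{(q)_n(q/az)_n}(b/a)^n . \]
   Context: For $|q|<1$ and complex $x$, $(x)_\infty=(x;q)_\infty=\prod_{k=0}^{\infty}(1-xq^k)$, and for any integer $n$ (positive, zero or negative), $(x)_n=(x)_\infty/(xq^n)_\infty$. *)

theory Defs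
  imports "HOL-Analysis.Analysis"
begin

definition qpoch_inf :: "complex \<Rightarrow> complex \<Rightarrow> complex" where
  "qpoch_inf q x = (\<Prod>k. 1 - x * q ^ k)"

text \<open>
  The symbol \<open>(x)\<^sub>n = (x)\<^sub>\<infinity> / (x q\<^sup>n)\<^sub>\<infinity>\<close> for an integer \<open>n\<close>. If \<open>x q\<^sup>n\<close> is a nonpositive power
  of \<open>q\<close>, the denominator vanishes, and the quotient is read after cancelling the common factors
  of the two products; this is the usual value, for instance, of the terminating symbol
  \<open>(q\<^sup>-\<^sup>m)\<^sub>n\<close>. If the cancelled form is itself a pole (\<open>n < 0\<close> and \<open>x = q\<^sup>m\<close> with
  \<open>1 \<le> m \<le> - n\<close>), division by zero gives the value 0, so that \<open>1 / (x)\<^sub>n\<close> is 0 as usual.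
\<close>

definition qpoch :: "complex \<Rightarrow> complex \<Rightarrow> int \<Rightarrow> complex" where
  "qpoch q x n =
     (if qpoch_inf q (x * q powi n) \<noteq> 0 then qpoch_inf q x / qpoch_inf q (x * q powi n)
      else if 0 \<le> n then (\<Prod>k<nat n. 1 - x * q ^ k)
      else 1 / (\<Prod>k=1..nat (- n). 1 - x / q ^ k))"

end

theory Submission
  imports Defs
begin

text \<open>
  The bilateral series splits at \<open>n = 0\<close> into two series of the shape \<open>\<Sum> (a)\<^sub>n / (b)\<^sub>n z\<^sup>n\<close>, the
  second one with \<open>(q/b, q/a, b/(az))\<close> in place of \<open>(a, b, z)\<close>. It therefore suffices to treat
  this series. With \<open>t = b/a\<close> and \<open>w = qz/t\<close> put
  \<open>E(a) = \<Sum> (w)\<^sub>n (a)\<^sub>n / (q)\<^sub>n (azq\<^sup>n)\<^sub>\<infinity> t\<^sup>n\<close>. Since \<open>(1 - azq\<^sup>n) - z(1 - aq\<^sup>n) = 1 - z\<close>, the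
  difference \<open>E(a) - z(1 - a) E(aq)\<close> is a multiple of a series summed by the \<open>q\<close>-Gauss theorem,
  which gives \<open>(t)\<^sub>\<infinity> E(a) = (z)\<^sub>\<infinity> (at)\<^sub>\<infinity> + z(1 - a) (t)\<^sub>\<infinity> E(aq)\<close>. Iterating this recurrence
  produces the series \<open>\<Sum> (a)\<^sub>n / (b)\<^sub>n z\<^sup>n\<close> term by term. This route avoids the analytic
  continuation needed to derive the transformation from Heine's. The \<open>q\<close>-Gauss theorem is proved
  in the same way, by a telescoping recurrence under \<open>t \<mapsto> tq\<close>.
\<close>

section \<open>Finite products and the normalised series term\<close>

definition qpoch_fin :: "complex \<Rightarrow> complex \<Rightarrow> nat \<Rightarrow> complex" where
  "qpoch_fin q x n = (\<Prod>k<n. 1 - x * q ^ k)"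

lemma qpoch_fin_0 [simp]: "qpoch_fin q x 0 = 1"
  by (simp add: qpoch_fin_def)

lemma qpoch_fin_Suc: "qpoch_fin q x (Suc n) = qpoch_fin q x n * (1 - x * q ^ n)"
  by (simp add: qpoch_fin_def)

lemma qpoch_fin_Suc_left: "qpoch_fin q x (Suc n) = (1 - x) * qpoch_fin q (x * q) n"
  by (simp add: qpoch_fin_def prod.lessThan_Suc_shift mult.assoc del: prod.lessThan_Suc)

lemma qpoch_fin_eq_0_iff: "qpoch_fin q x n = 0 \<longleftrightarrow> (\<exists>k<n. x * q ^ k = 1)"
  by (auto simp: qpoch_fin_def)

text \<open>Since (v)_inf = (v)_n (v q^n)_inf, this is (v)_inf times the n-th term of the basic
  hypergeometric series with upper parameters w, a, lower parameter v and argument t. Carrying the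
  tail as a factor keeps the term meaningful when (v)_n vanishes.\<close>

definition heine_term ::
    "complex \<Rightarrow> complex \<Rightarrow> complex \<Rightarrow> complex \<Rightarrow> complex \<Rightarrow> nat \<Rightarrow> complex" where
  "heine_term q w a v t n =
     qpoch_fin q w n * qpoch_fin q a n / qpoch_fin q q n * qpoch_inf q (v * q ^ n) * t ^ n"

context
  fixes q :: complex
  assumes norm_q: "norm q < 1"
begin

section \<open>Convergence, zeros and splitting of the infinite product\<close>

lemma convergent_prod_qpoch: "convergent_prod (\<lambda>k. 1 - x * q ^ k)"
proof -
  have "summable (\<lambda>k. norm (1 - x * q ^ k - 1))"
    using norm_q by (simp add: norm_mult norm_power)
  thus ?thesis
    by (intro abs_convergent_prod_imp_convergent_prod summable_imp_abs_convergent_prod)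
qed

lemma qpoch_fin_tendsto: "qpoch_fin q x \<longlonglongrightarrow> qpoch_inf q x"
proof -
  have "(\<lambda>k. 1 - x * q ^ k) has_prod qpoch_inf q x"
    using convergent_prod_has_prod[OF convergent_prod_qpoch] by (simp add: qpoch_inf_def)
  from has_prod_imp_tendsto'[OF this] show ?thesis
    by (simp add: qpoch_fin_def[abs_def])
qed

lemma qpoch_inf_eq_0_iff: "qpoch_inf q x = 0 \<longleftrightarrow> (\<exists>k. x * q ^ k = 1)"
proof -
  have "(\<lambda>k. 1 - x * q ^ k) has_prod qpoch_inf q x"
    using convergent_prod_has_prod[OF convergent_prod_qpoch] by (simp add: qpoch_inf_def)
  from has_prod_eq_0_iff[OF this] show ?thesis
    by (auto simp: image_iff)
qed

lemma qpoch_inf_nonzero: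
  assumes "norm x < 1"
  shows "qpoch_inf q x \<noteq> 0"
proof -
  have "norm (x * q ^ k) < 1" for k
  proof -
    have "norm x * norm q ^ k \<le> norm x * 1"
      using norm_q by (intro mult_left_mono power_le_one) auto
    thus ?thesis using assms by (simp add: norm_mult norm_power)
  qed
  hence "x * q ^ k \<noteq> 1" for k
    by (metis norm_one less_irrefl)
  thus ?thesis by (auto simp: qpoch_inf_eq_0_iff)
qed

lemma qpoch_fin_q_nonzero: "qpoch_fin q q n \<noteq> 0"
  using qpoch_inf_nonzero[OF norm_q] by (auto simp: qpoch_inf_eq_0_iff qpoch_fin_eq_0_iff)

lemma qpoch_inf_split: "qpoch_inf q x = qpoch_fin q x n * qpoch_inf q (x * q ^ n)"
proof (induction n)
  case (Suc n)
  have step: "qpoch_inf q y = (1 - y) * qpoch_inf q (y * q)" for y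
  proof (rule LIMSEQ_unique)
    show "(\<lambda>n. qpoch_fin q y (Suc n)) \<longlonglongrightarrow> qpoch_inf q y"
      using qpoch_fin_tendsto by (rule LIMSEQ_Suc)
    show "(\<lambda>n. qpoch_fin q y (Suc n)) \<longlonglongrightarrow> (1 - y) * qpoch_inf q (y * q)"
      unfolding qpoch_fin_Suc_left by (intro tendsto_intros qpoch_fin_tendsto)
  qed
  show ?case
    using Suc step[of "x * q ^ n"] by (simp add: qpoch_fin_Suc mult_ac)
qed simp

lemma qpoch_inf_Suc: "qpoch_inf q x = (1 - x) * qpoch_inf q (x * q)"
  using qpoch_inf_split[of x 1] by (simp add: qpoch_fin_Suc)

section \<open>Uniform estimates for the products and the series\<close>

lemma norm_qpoch_fin_minus_1: "norm (qpoch_fin q x n - 1) \<le> exp (norm x / (1 - norm q)) - 1"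
proof -
  have "norm (qpoch_fin q x n - 1) = norm ((\<Prod>k<n. 1 + (- (x * q ^ k))) - 1)"
    by (simp add: qpoch_fin_def)
  also have "\<dots> \<le> (\<Prod>k<n. 1 + norm (- (x * q ^ k))) - 1"
    by (rule norm_prod_minus1_le_prod_minus1)
  \<comment> \<open>By 1 + y <= exp y the product becomes the exponential of a geometric sum. The
    resulting bound is independent of n and vanishes with x, so it yields both boundedness and the
    limit 1 as x tends to 0.\<close>
  also have "(\<Prod>k<n. 1 + norm (- (x * q ^ k))) \<le> (\<Prod>k<n. exp (norm x * norm q ^ k))"
    by (intro prod_mono) (auto simp: norm_mult norm_power)
  also have "\<dots> = exp (norm x * (\<Sum>k<n. norm q ^ k))"
    by (simp add: exp_sum sum_distrib_left)
  also have "(\<Sum>k<n. norm q ^ k) \<le> (\<Sum>k. norm q ^ k)"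
    using norm_q by (intro sum_le_suminf) auto
  also have "(\<Sum>k. norm q ^ k) = 1 / (1 - norm q)"
    using norm_q by (intro suminf_geometric) auto
  finally show ?thesis by (simp add: mult_left_mono)
qed

lemma norm_qpoch_inf_minus_1: "norm (qpoch_inf q x - 1) \<le> exp (norm x / (1 - norm q)) - 1"
proof (rule tendsto_upperbound)
  show "(\<lambda>n. norm (qpoch_fin q x n - 1)) \<longlonglongrightarrow> norm (qpoch_inf q x - 1)"
    by (intro tendsto_intros qpoch_fin_tendsto)
qed (auto intro!: always_eventually norm_qpoch_fin_minus_1)

lemma norm_qpoch_fin_le:
  assumes "norm x \<le> r"
  shows "norm (qpoch_fin q x n) \<le> exp (r / (1 - norm q))"
proof -
  have "norm (qpoch_fin q x n) \<le> exp (norm x / (1 - norm q))"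
    using norm_qpoch_fin_minus_1[of x n] norm_triangle_ineq[of "qpoch_fin q x n - 1" 1] by simp
  also have "\<dots> \<le> exp (r / (1 - norm q))"
    using assms norm_q by (simp add: divide_right_mono)
  finally show ?thesis .
qed

lemma norm_qpoch_inf_le:
  assumes "norm x \<le> r"
  shows "norm (qpoch_inf q x) \<le> exp (r / (1 - norm q))"
proof (rule tendsto_upperbound)
  show "(\<lambda>n. norm (qpoch_fin q x n)) \<longlonglongrightarrow> norm (qpoch_inf q x)"
    by (intro tendsto_intros qpoch_fin_tendsto)
qed (auto intro!: always_eventually norm_qpoch_fin_le[OF assms])

lemma qpoch_inf_tendsto_1:
  assumes "x \<longlonglongrightarrow> 0"
  shows "(\<lambda>n. qpoch_inf q (x n)) \<longlonglongrightarrow> 1"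
proof -
  have "(\<lambda>n. exp (norm (x n) / (1 - norm q)) - 1) \<longlonglongrightarrow> exp (norm (0::complex) / (1 - norm q)) - 1"
    using assms norm_q by (intro tendsto_intros) auto
  hence "(\<lambda>n. exp (norm (x n) / (1 - norm q)) - 1) \<longlonglongrightarrow> 0" by simp
  hence "(\<lambda>n. qpoch_inf q (x n) - 1) \<longlonglongrightarrow> 0"
    by (rule Lim_null_comparison[rotated]) (auto intro!: always_eventually norm_qpoch_inf_minus_1)
  thus ?thesis by (simp add: LIM_zero_iff)
qed

text \<open>The hypothesis makes the limit (x)_inf nonzero, so the reciprocals converge and are
  therefore bounded.\<close>

lemma qpoch_fin_inverse_bounded:
  assumes "\<And>k. x * q ^ k \<noteq> 1"
  obtains C where "C > 0" "\<And>n. norm (inverse (qpoch_fin q x n)) \<le> C"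
proof -
  have "(\<lambda>n. inverse (qpoch_fin q x n)) \<longlonglongrightarrow> inverse (qpoch_inf q x)"
    using assms by (intro tendsto_inverse qpoch_fin_tendsto) (auto simp: qpoch_inf_eq_0_iff)
  hence "Bseq (\<lambda>n. inverse (qpoch_fin q x n))"
    by (intro convergent_imp_Bseq) (auto simp: convergent_def)
  thus ?thesis using that by (auto simp: Bseq_def)
qed

text \<open>The uniformity of C is what the limits below require: \<open>heine_sum_tendsto_1\<close>
  varies v and t, and \<open>qpoch_ratio_sums_heine\<close> varies a and v, each within a fixed
  disc.\<close>

lemma heine_term_bound:
  "\<exists>C>0. \<forall>a v t n. norm a \<le> r \<longrightarrow> norm v \<le> s \<longrightarrow>
     norm (heine_term q w a v t n) \<le> C * norm t ^ n"
proof -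
  let ?e = "\<lambda>r. exp (r / (1 - norm q))"
  have "\<And>k. q * q ^ k \<noteq> 1"
    using qpoch_inf_nonzero[OF norm_q] by (auto simp: qpoch_inf_eq_0_iff)
  then obtain D where D: "D > 0" "\<And>n. norm (inverse (qpoch_fin q q n)) \<le> D"
    by (rule qpoch_fin_inverse_bounded) auto
  show ?thesis
  proof (intro exI[of _ "?e (norm w) * ?e r * D * ?e s"] conjI allI impI)
    show "?e (norm w) * ?e r * D * ?e s > 0" using D by simp
    fix a v t :: complex and n :: nat
    assume a: "norm a \<le> r" and v: "norm v \<le> s"
    have "norm v * norm q ^ n \<le> norm v * 1"
      using norm_q by (intro mult_left_mono power_le_one) auto
    hence v': "norm (v * q ^ n) \<le> s" using v by (simp add: norm_mult norm_power)
    have "norm (heine_term q w a v t n) = norm (qpoch_fin q w n) * norm (qpoch_fin q a n) *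
            norm (inverse (qpoch_fin q q n)) * norm (qpoch_inf q (v * q ^ n)) * norm t ^ n"
      by (simp add: heine_term_def norm_mult norm_divide norm_inverse norm_power divide_inverse)
    also have "\<dots> \<le> ?e (norm w) * ?e r * D * ?e s * norm t ^ n"
      using D by (intro mult_right_mono mult_mono norm_qpoch_fin_le norm_qpoch_inf_le a v' order.refl) auto
    finally show "norm (heine_term q w a v t n) \<le> ?e (norm w) * ?e r * D * ?e s * norm t ^ n" .
  qed
qed

lemma summable_heine_term:
  assumes "norm t < 1"
  shows "summable (heine_term q w a v t)"
proof -
  obtain C where C: "\<forall>b u t' n. norm b \<le> norm a \<longrightarrow> norm u \<le> norm v \<longrightarrow>
       norm (heine_term q w b u t' n) \<le> C * norm t' ^ n"
    using heine_term_bound[of "norm a" "norm v" w] by blast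
  show ?thesis
  proof (rule summable_comparison_test')
    show "summable (\<lambda>n. C * norm t ^ n)" using assms by simp
    show "norm (heine_term q w a v t n) \<le> C * norm t ^ n" for n
      using C by simp
  qed
qed

section \<open>The q-Gauss sum\<close>

lemma qGauss_step:
  assumes "norm t < 1"
  shows "(1 - t) * suminf (heine_term q w a (a * w * t) t) =
         (1 - w * t) * (1 - a * t) * suminf (heine_term q w a (a * w * (t * q)) (t * q))"
proof -
  define T where "T = heine_term q w a (a * w * t) t"
  define T' where "T' = heine_term q w a (a * w * (t * q)) (t * q)"
  \<comment> \<open>The telescoping certificate: the factor \<open>1 - q ^ n\<close> makes
    \<open>g 0 = 0\<close>, and \<open>g\<close> tends to 0 with \<open>T\<close>, so the
    differences of \<open>g\<close> sum to 0.\<close>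
  define g where "g n = (1 - q ^ n) * T n" for n
  have "norm t * norm q \<le> norm t * 1"
    using norm_q by (intro mult_left_mono) auto
  hence tq: "norm (t * q) < 1" using assms by (simp add: norm_mult)
  have sums: "T sums suminf T" "T' sums suminf T'"
    using summable_heine_term[OF assms] summable_heine_term[OF tq]
    by (auto simp: T_def T'_def)
  have tele: "(1 - t) * T n - (1 - w * t) * (1 - a * t) * T' n = g n - g (Suc n)" for n
  proof -
    define Q where "Q = q ^ n"
    define X where "X = qpoch_inf q (a * w * t * q ^ n * q)"
    define R where "R = qpoch_fin q w n * qpoch_fin q a n / qpoch_fin q q n * X * t ^ n"
    have T: "T n = (1 - a * w * t * Q) * R"
      using qpoch_inf_Suc[of "a * w * t * q ^ n"]
      by (simp add: T_def heine_term_def R_def X_def Q_def)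
    have T': "T' n = Q * R"
      by (simp add: T'_def heine_term_def R_def X_def Q_def power_mult_distrib mult_ac)
    \<comment> \<open>In \<open>g (Suc n)\<close> the factor \<open>1 - q ^ Suc n\<close> has to
      cancel the last factor of \<open>qpoch_fin q q (Suc n)\<close>.\<close>
    have "1 - q * q ^ n \<noteq> 0"
      using qpoch_fin_q_nonzero[of "Suc n"] by (simp add: qpoch_fin_Suc)
    hence gS: "g (Suc n) = t * (1 - w * Q) * (1 - a * Q) * R"
      using qpoch_fin_q_nonzero[of n]
      by (simp add: g_def T_def heine_term_def R_def X_def Q_def qpoch_fin_Suc mult_ac)
    have g: "g n = (1 - Q) * ((1 - a * w * t * Q) * R)"
      by (simp add: g_def T Q_def)
    \<comment> \<open>Apart from the common factor R this is the polynomial identity (1 - t)(1 -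
      awtQ) - (1 - wt)(1 - at)Q = (1 - Q)(1 - awtQ) - t(1 - wQ)(1 - aQ).\<close>
    show ?thesis unfolding gS g T T' by (simp add: algebra_simps)
  qed
  have "g \<longlonglongrightarrow> (1 - 0) * 0"
    unfolding g_def using summable_LIMSEQ_zero[OF sums_summable[OF sums(1)]] norm_q
    by (intro tendsto_intros LIMSEQ_power_zero) auto
  from telescope_sums'[OF this] have "(\<lambda>n. g n - g (Suc n)) sums 0"
    by (simp add: g_def)
  moreover have "(\<lambda>n. (1 - t) * T n - (1 - w * t) * (1 - a * t) * T' n) sums
      ((1 - t) * suminf T - (1 - w * t) * (1 - a * t) * suminf T')"
    by (intro sums_diff sums_mult sums)
  ultimately have "(1 - t) * suminf T - (1 - w * t) * (1 - a * t) * suminf T' = 0"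
    unfolding tele by (rule sums_unique2[symmetric])
  thus ?thesis by (simp add: T_def T'_def)
qed

text \<open>As the argument t q^N tends to 0, only the term n = 0 survives. It equals (a w t
  q^N)_inf, which tends to 1; the uniform bound makes the rest O(|t q^N|).\<close>

lemma heine_sum_tendsto_1:
  assumes t: "norm t < 1"
  shows "(\<lambda>N. suminf (heine_term q w a (a * w * (t * q ^ N)) (t * q ^ N))) \<longlonglongrightarrow> 1"
proof -
  define s where "s N = t * q ^ N" for N
  define H where "H N = suminf (heine_term q w a (a * w * s N) (s N))" for N
  have ns: "norm (s N) \<le> norm t" for N
  proof -
    have "norm t * norm q ^ N \<le> norm t * 1"
      using norm_q by (intro mult_left_mono power_le_one) auto
    thus ?thesis by (simp add: s_def norm_mult norm_power)
  qed
  have s0: "s \<longlonglongrightarrow> 0"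
    unfolding s_def using norm_q by (intro tendsto_mult_right_zero LIMSEQ_power_zero) auto
  obtain C where C: "C > 0" "\<forall>b v t' n. norm b \<le> norm a \<longrightarrow> norm v \<le> norm (a * w * t) \<longrightarrow>
       norm (heine_term q w b v t' n) \<le> C * norm t' ^ n"
    using heine_term_bound[of "norm a" "norm (a * w * t)" w] by blast
  have bound: "norm (H N - qpoch_inf q (a * w * s N)) \<le> C * norm (s N) / (1 - norm t)" for N
  proof -
    define T where "T = heine_term q w a (a * w * s N) (s N)"
    have s1: "norm (s N) < 1" using ns[of N] t by linarith
    have "summable T" unfolding T_def by (rule summable_heine_term[OF s1])
    hence "H N = T 0 + (\<Sum>n. T (Suc n))"
      by (simp add: H_def T_def suminf_split_head)
    moreover have "T 0 = qpoch_inf q (a * w * s N)"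
      by (simp add: T_def heine_term_def)
    ultimately have "H N - qpoch_inf q (a * w * s N) = (\<Sum>n. T (Suc n))" by simp
    also have "norm \<dots> \<le> (\<Sum>n. C * norm (s N) * norm t ^ n)"
    proof (rule norm_suminf_le)
      fix n
      have "norm (T (Suc n)) \<le> C * norm (s N) ^ Suc n"
        unfolding T_def using ns[of N] by (intro C(2)[rule_format]) (auto simp: norm_mult mult_left_mono)
      also have "\<dots> = C * norm (s N) * norm (s N) ^ n" by simp
      \<comment> \<open>One factor |s N| is kept to force decay in N; the others are weakened to |t|
        to leave a fixed geometric series.\<close>
      also have "\<dots> \<le> C * norm (s N) * norm t ^ n"
        using C(1) ns[of N] by (intro mult_left_mono power_mono) auto
      finally show "norm (T (Suc n)) \<le> C * norm (s N) * norm t ^ n" .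
    qed (use t in auto)
    also have "\<dots> = C * norm (s N) / (1 - norm t)"
      using t by (subst suminf_mult) (auto simp: suminf_geometric)
    finally show ?thesis .
  qed
  have "(\<lambda>N. C * norm (s N) / (1 - norm t)) \<longlonglongrightarrow> C * norm (0::complex) / (1 - norm t)"
    using t by (intro tendsto_intros s0) auto
  hence "(\<lambda>N. C * norm (s N) / (1 - norm t)) \<longlonglongrightarrow> 0" by simp
  hence "(\<lambda>N. H N - qpoch_inf q (a * w * s N)) \<longlonglongrightarrow> 0"
    by (rule Lim_null_comparison[rotated]) (auto intro!: always_eventually bound)
  moreover have "(\<lambda>N. qpoch_inf q (a * w * s N)) \<longlonglongrightarrow> 1"
    by (intro qpoch_inf_tendsto_1 tendsto_mult_right_zero s0)
  ultimately have "(\<lambda>N. (H N - qpoch_inf q (a * w * s N)) + qpoch_inf q (a * w * s N)) \<longlonglongrightarrow> 0 + 1"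
    by (rule tendsto_add)
  thus ?thesis by (simp add: H_def s_def)
qed

text \<open>The q-Gauss sum with lower parameter c = awt, so that t = c/(aw), wt = c/a and at = c/w,
  after multiplication by (c)_inf (t)_inf. It follows by iterating \<open>qGauss_step\<close> and
  letting the argument shrink to 0.\<close>

theorem qGauss:
  assumes t: "norm t < 1"
  shows "qpoch_inf q t * suminf (heine_term q w a (a * w * t) t) =
         qpoch_inf q (w * t) * qpoch_inf q (a * t)"
proof -
  define H where "H N = suminf (heine_term q w a (a * w * (t * q ^ N)) (t * q ^ N))" for N
  have ns: "norm (t * q ^ N) < 1" for N
  proof -
    have "norm t * norm q ^ N \<le> norm t * 1"
      using norm_q by (intro mult_left_mono power_le_one) auto
    thus ?thesis using t by (simp add: norm_mult norm_power)
  qed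
  have iter: "qpoch_fin q t N * H 0 = qpoch_fin q (w * t) N * qpoch_fin q (a * t) N * H N" for N
  proof (induction N)
    case (Suc N)
    have step: "(1 - t * q ^ N) * H N =
        (1 - w * (t * q ^ N)) * (1 - a * (t * q ^ N)) * H (Suc N)"
      using qGauss_step[OF ns[of N], of w a] by (simp add: H_def mult_ac)
    have "qpoch_fin q t (Suc N) * H 0 = (1 - t * q ^ N) * (qpoch_fin q t N * H 0)"
      by (simp add: qpoch_fin_Suc)
    also have "\<dots> = qpoch_fin q (w * t) N * qpoch_fin q (a * t) N * ((1 - t * q ^ N) * H N)"
      unfolding Suc by simp
    also have "\<dots> = qpoch_fin q (w * t) (Suc N) * qpoch_fin q (a * t) (Suc N) * H (Suc N)"
      unfolding step by (simp add: qpoch_fin_Suc mult.assoc)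
    finally show ?case .
  qed simp
  have "H \<longlonglongrightarrow> 1"
    unfolding H_def by (rule heine_sum_tendsto_1[OF t])
  hence "(\<lambda>N. qpoch_fin q (w * t) N * qpoch_fin q (a * t) N * H N) \<longlonglongrightarrow>
      qpoch_inf q (w * t) * qpoch_inf q (a * t) * 1"
    by (intro tendsto_mult qpoch_fin_tendsto)
  moreover have "(\<lambda>N. qpoch_fin q t N * H 0) \<longlonglongrightarrow> qpoch_inf q t * H 0"
    by (intro tendsto_intros qpoch_fin_tendsto)
  ultimately have "qpoch_inf q t * H 0 = qpoch_inf q (w * t) * qpoch_inf q (a * t) * 1"
    unfolding iter by (rule LIMSEQ_unique[rotated])
  thus ?thesis by (simp add: H_def)
qed

section \<open>Transformation of the one-sided series\<close>

lemma heine_recurrence: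
  assumes t: "norm t < 1" and w: "w * t = z * q"
  shows "qpoch_inf q t * suminf (heine_term q w a (a * z) t) =
         qpoch_inf q z * qpoch_inf q (a * t) +
         z * (1 - a) * (qpoch_inf q t * suminf (heine_term q w (a * q) (a * q * z) t))"
proof -
  let ?T = "heine_term q w a (a * z) t"
  let ?X = "heine_term q w a (a * w * t) t"
  let ?U = "heine_term q w (a * q) (a * q * z) t"
  have T: "?T n = (1 - z) * ?X n + z * (1 - a) * ?U n" for n
  proof -
    define R where
      "R = qpoch_fin q w n / qpoch_fin q q n * qpoch_inf q (a * z * q ^ n * q) * t ^ n"
    \<comment> \<open>Taking the factor 1 - azq^n out of the tail moves the lower parameter from az
      to azq. The condition on w makes this awt, the value at which q-Gauss applies.\<close>
    have v: "a * w * t = a * z * q"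
      using w by (simp add: mult.assoc)
    have X: "?X n = qpoch_fin q a n * R"
      unfolding v by (simp add: heine_term_def R_def mult_ac)
    \<comment> \<open>Because (1 - a)(aq)_n = (a)_n (1 - aq^n), the series at aq has the same common
      factor as the other two.\<close>
    have "(1 - a) * ?U n = qpoch_fin q a (Suc n) * R"
      unfolding qpoch_fin_Suc_left by (simp add: heine_term_def R_def mult_ac)
    hence U: "(1 - a) * ?U n = qpoch_fin q a n * (1 - a * q ^ n) * R"
      by (simp add: qpoch_fin_Suc)
    have "?T n = qpoch_fin q a n * (1 - a * z * q ^ n) * R"
      using qpoch_inf_Suc[of "a * z * q ^ n"] by (simp add: heine_term_def R_def)
    also have "\<dots> = (1 - z) * (qpoch_fin q a n * R) +
        z * (qpoch_fin q a n * (1 - a * q ^ n) * R)"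
      by (simp add: algebra_simps)
    finally show ?thesis unfolding X U[symmetric] by (simp add: mult.assoc)
  qed
  have E: "suminf ?T = (1 - z) * suminf ?X + z * (1 - a) * suminf ?U"
    unfolding T
    by (intro sums_unique[symmetric] sums_add sums_mult summable_sums summable_heine_term t)
  have "qpoch_inf q t * suminf ?T = (1 - z) * (qpoch_inf q t * suminf ?X) +
      z * (1 - a) * (qpoch_inf q t * suminf ?U)"
    unfolding E by (simp add: algebra_simps)
  \<comment> \<open>Here (wt)_inf = (zq)_inf, and the factor 1 - z completes it to (z)_inf.\<close>
  also have "(1 - z) * (qpoch_inf q t * suminf ?X) = qpoch_inf q z * qpoch_inf q (a * t)"
    using qGauss[OF t, of w a] qpoch_inf_Suc[of z] by (simp add: w)
  finally show ?thesis .
qed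

lemma heine_iterate:
  assumes t: "norm t < 1" and w: "w * t = z * q"
  shows "qpoch_inf q t * suminf (heine_term q w a (a * z) t) =
    qpoch_inf q z * (\<Sum>n<N. qpoch_fin q a n * qpoch_inf q (a * t * q ^ n) * z ^ n) +
    z ^ N * qpoch_fin q a N *
      (qpoch_inf q t * suminf (heine_term q w (a * q ^ N) (a * q ^ N * z) t))"
proof (induction N)
  case (Suc N)
  show ?case
    unfolding Suc heine_recurrence[OF t w, of "a * q ^ N"]
    by (simp add: qpoch_fin_Suc algebra_simps)
qed simp

text \<open>The remainder after N iterations is z^N times a bounded sequence, because aq^N and aq^N
  z stay in fixed discs. It vanishes in the limit, so the formula for the partial sums yields
  convergence and value together.\<close>

lemma qpoch_ratio_sums_heine:
  assumes z: "norm z < 1" and t: "norm t < 1" and w: "w * t = z * q"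
  shows "(\<lambda>n. qpoch_fin q a n * qpoch_inf q (a * t * q ^ n) * z ^ n) sums
         (qpoch_inf q t * suminf (heine_term q w a (a * z) t) / qpoch_inf q z)"
proof -
  define E where "E N = suminf (heine_term q w (a * q ^ N) (a * q ^ N * z) t)" for N
  define S where "S N = (\<Sum>n<N. qpoch_fin q a n * qpoch_inf q (a * t * q ^ n) * z ^ n)" for N
  have na: "norm (a * q ^ N) \<le> norm a" for N
  proof -
    have "norm a * norm q ^ N \<le> norm a * 1"
      using norm_q by (intro mult_left_mono power_le_one) auto
    thus ?thesis by (simp add: norm_mult norm_power)
  qed
  obtain C where "C > 0" and C: "\<forall>b v t' n. norm b \<le> norm a \<longrightarrow> norm v \<le> norm a * norm z \<longrightarrow>
       norm (heine_term q w b v t' n) \<le> C * norm t' ^ n"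
    using heine_term_bound[of "norm a" "norm a * norm z" w] by blast
  have "norm (E N) \<le> (\<Sum>n. C * norm t ^ n)" for N
    unfolding E_def
  proof (rule norm_suminf_le)
    show "norm (heine_term q w (a * q ^ N) (a * q ^ N * z) t n) \<le> C * norm t ^ n" for n
      using na[of N] by (intro C[rule_format]) (auto simp: norm_mult intro!: mult_right_mono)
  qed (use t in auto)
  hence E: "Bseq E" by (rule BseqI')
  have "Bseq (\<lambda>N. qpoch_fin q a N * (qpoch_inf q t * E N))"
    by (intro Bseq_mult E Bfun_const convergent_imp_Bseq)
      (use qpoch_fin_tendsto in \<open>auto simp: convergent_def\<close>)
  then obtain B where "\<And>N. norm (qpoch_fin q a N * (qpoch_inf q t * E N)) \<le> B"
    by (auto simp: Bseq_def)
  hence rem: "(\<lambda>N. z ^ N * (qpoch_fin q a N * (qpoch_inf q t * E N))) \<longlonglongrightarrow> 0"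
    using z by (intro lim_null_mult_right_bounded[where B = B] LIMSEQ_power_zero) auto
  have z0: "qpoch_inf q z \<noteq> 0" by (rule qpoch_inf_nonzero[OF z])
  have S: "S = (\<lambda>N. (qpoch_inf q t * E 0 - z ^ N * (qpoch_fin q a N * (qpoch_inf q t * E N)))
      / qpoch_inf q z)"
  proof
    show "S N = (qpoch_inf q t * E 0 - z ^ N * (qpoch_fin q a N * (qpoch_inf q t * E N)))
      / qpoch_inf q z" for N
      using heine_iterate[OF t w, of a N] z0 by (simp add: S_def E_def field_simps)
  qed
  have "(\<lambda>N. (qpoch_inf q t * E 0 - z ^ N * (qpoch_fin q a N * (qpoch_inf q t * E N)))
      / qpoch_inf q z) \<longlonglongrightarrow> (qpoch_inf q t * E 0 - 0) / qpoch_inf q z"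
    by (intro tendsto_intros rem z0)
  hence "S \<longlonglongrightarrow> qpoch_inf q t * E 0 / qpoch_inf q z" by (simp add: S)
  thus ?thesis by (simp add: sums_def S_def[abs_def] E_def)
qed

section \<open>The symbol at integer indices\<close>

lemma qpoch_nat: "qpoch q x (int n) = qpoch_fin q x n"
  \<comment> \<open>If the tail vanishes, the definition itself gives the finite product; otherwise
    the split cancels the tail.\<close>
  using qpoch_inf_split[of x n] by (auto simp: qpoch_def qpoch_fin_def)

lemma qpoch_neg:
  assumes q: "q \<noteq> 0"
  shows "qpoch q x (- int n) = 1 / (\<Prod>k=1..n. 1 - x / q ^ k)"
proof -
  have "qpoch_fin q (x / q ^ n) n = (\<Prod>k=1..n. 1 - x / q ^ k)"
    unfolding qpoch_fin_def
  proof (rule prod.reindex_bij_witness[of _ "\<lambda>k. n - k" "\<lambda>k. n - k"])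
    fix k assume "k \<in> {..<n}"
    thus "1 - x / q ^ (n - k) = 1 - x / q ^ n * q ^ k"
      using q by (simp add: power_diff)
  qed auto
  hence split: "qpoch_inf q (x / q ^ n) = (\<Prod>k=1..n. 1 - x / q ^ k) * qpoch_inf q x"
    using qpoch_inf_split[of "x / q ^ n" n] q by simp
  have "x * q powi (- int n) = x / q ^ n"
    by (simp add: power_int_minus divide_inverse)
  thus ?thesis
    \<comment> \<open>If (x/q^n)_inf is nonzero, so is (x)_inf, which cancels. Otherwise the
      definition already gives the right side, with \<open>1 / 0 = 0\<close> at a pole.\<close>
    using split by (auto simp: qpoch_def)
qed

text \<open>With Q = q^(k+1), 1 - b/Q = -(b/Q)(1 - Q/b), and likewise for a. In the quotient the
  signs and powers of Q cancel, leaving one factor b/a per index, which combines with 1/z.\<close>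

lemma qpoch_neg_ratio:
  assumes "q \<noteq> 0" "a \<noteq> 0" "b \<noteq> 0"
  shows "qpoch q a (- int n) / qpoch q b (- int n) * z powi (- int n) =
         qpoch_fin q (q / b) n / qpoch_fin q (q / a) n * (b / (a * z)) ^ n"
proof -
  \<comment> \<open>If b = q^m with 1 <= m <= n, both sides are 0 by the convention for division by
    zero.\<close>
  have "qpoch q a (- int n) / qpoch q b (- int n) =
      (\<Prod>k=1..n. (1 - b / q ^ k) / (1 - a / q ^ k))"
    using assms(1) by (simp add: qpoch_neg prod_dividef)
  also have "\<dots> = (\<Prod>k<n. (1 - b / q ^ Suc k) / (1 - a / q ^ Suc k))"
    by (simp add: prod.atLeast1_atMost_eq)
  also have "\<dots> = (\<Prod>k<n. b / a * ((1 - q / b * q ^ k) / (1 - q / a * q ^ k)))"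
  proof (rule prod.cong)
    fix k
    define Q where "Q = q ^ Suc k"
    have Q: "Q \<noteq> 0" using assms by (simp add: Q_def)
    have "1 - b / Q = (- b / Q) * (1 - Q / b)" "1 - a / Q = (- a / Q) * (1 - Q / a)"
      using Q assms by (simp_all add: field_simps)
    hence "(1 - b / Q) / (1 - a / Q) = (- b / Q) / (- a / Q) * ((1 - Q / b) / (1 - Q / a))"
      by simp
    also have "(- b / Q) / (- a / Q) = b / a" using Q by simp
    finally show "(1 - b / q ^ Suc k) / (1 - a / q ^ Suc k) =
        b / a * ((1 - q / b * q ^ k) / (1 - q / a * q ^ k))"
      by (simp add: Q_def)
  qed auto
  also have "\<dots> = (b / a) ^ n * (qpoch_fin q (q / b) n / qpoch_fin q (q / a) n)"
    by (simp only: prod.distrib prod_dividef qpoch_fin_def prod_constant card_lessThan power_divide)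
  finally show ?thesis
    by (simp add: power_int_minus power_divide power_mult_distrib field_simps)
qed

text \<open>Dividing by (b)_inf turns the tails (bq^n)_inf into 1/(b)_n, and extracting (az)_inf
  from \<open>heine_term\<close> does the same for (az)_n. Absolute summability is recorded because
  the sum over the integers is unordered.\<close>

theorem Heine_q_transformation:
  assumes z: "norm z < 1" and t: "norm (b / a) < 1" and a: "a \<noteq> 0" and b: "b \<noteq> 0"
    and b1: "\<And>k. b * q ^ k \<noteq> 1" and az1: "\<And>k. a * z * q ^ k \<noteq> 1"
  defines "f \<equiv> \<lambda>n. qpoch_fin q a n / qpoch_fin q b n * z ^ n"
    and "g \<equiv> \<lambda>n. qpoch_fin q (a * q * z / b) n * qpoch_fin q a n
          / (qpoch_fin q q n * qpoch_fin q (a * z) n) * (b / a) ^ n"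
  shows "summable (\<lambda>n. norm (f n))" and "summable g"
    and "f sums (qpoch_inf q (b / a) * qpoch_inf q (a * z) / (qpoch_inf q b * qpoch_inf q z)
           * suminf g)"
proof -
  define w where "w = a * q * z / b"
  define T where "T = heine_term q w a (a * z) (b / a)"
  have w: "w * (b / a) = z * q" using a b by (simp add: w_def)
  have b0: "qpoch_inf q b \<noteq> 0" and az0: "qpoch_inf q (a * z) \<noteq> 0"
    using b1 az1 by (auto simp: qpoch_inf_eq_0_iff)
  have g: "T n = qpoch_inf q (a * z) * g n" for n
    using qpoch_inf_split[of "a * z" n] az0 by (simp add: T_def heine_term_def g_def w_def)
  have f: "qpoch_fin q a n * qpoch_inf q (a * (b / a) * q ^ n) * z ^ n = qpoch_inf q b * f n" for n
    using qpoch_inf_split[of b n] b0 a by (simp add: f_def)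
  have sT: "summable T" unfolding T_def by (rule summable_heine_term[OF t])
  have "(\<lambda>n. qpoch_inf q (a * z) * g n) = T" using g by auto
  with sT show sg: "summable g"
    using az0 by (metis summable_mult_D)
  hence T: "suminf T = qpoch_inf q (a * z) * suminf g"
    unfolding g by (rule suminf_mult)
  have "(\<lambda>n. qpoch_inf q b * f n) sums
      (qpoch_inf q (b / a) * suminf T / qpoch_inf q z)"
    using qpoch_ratio_sums_heine[OF z t w, of a] unfolding f T_def .
  from sums_mult[OF this, of "inverse (qpoch_inf q b)"]
  show "f sums (qpoch_inf q (b / a) * qpoch_inf q (a * z) / (qpoch_inf q b * qpoch_inf q z)
           * suminf g)"
    using b0 by (simp add: T field_simps)
  obtain C where C: "\<And>n. norm (inverse (qpoch_fin q b n)) \<le> C"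
    using qpoch_fin_inverse_bounded[OF b1] by metis
  let ?D = "exp (norm a / (1 - norm q)) * C"
  show "summable (\<lambda>n. norm (f n))"
  proof (rule summable_comparison_test')
    show "summable (\<lambda>n. ?D * norm z ^ n)" using z by (intro summable_mult summable_geometric) simp
    fix n
    have "norm (f n) = norm (qpoch_fin q a n) * norm (inverse (qpoch_fin q b n)) * norm z ^ n"
      by (simp add: f_def norm_mult norm_divide norm_inverse norm_power divide_inverse)
    also have "\<dots> \<le> ?D * norm z ^ n"
      by (intro mult_right_mono mult_mono norm_qpoch_fin_le C order.refl) auto
    finally show "norm (norm (f n)) \<le> ?D * norm z ^ n" by simp
  qed
qed

end

section \<open>The bilateral series\<close>

lemma has_sum_int_from_halves:
  fixes f :: "int \<Rightarrow> 'a :: banach"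
  assumes "summable (\<lambda>n. norm (f (int n)))" "(\<lambda>n. f (int n)) sums A"
    and "summable (\<lambda>n. norm (f (- int n)))" "(\<lambda>n. f (- int n)) sums B"
  shows "(f has_sum (A + (B - f 0))) UNIV"
proof -
  have "(f has_sum A) (range int)"
    by (subst has_sum_reindex)
      (use norm_summable_imp_has_sum[OF assms(1,2)] in \<open>auto simp: o_def\<close>)
  \<comment> \<open>The second series also contains the term at 0, so the negative integers
    contribute only \<open>B - f 0\<close>. With \<open>f 0 = 1\<close> this is the source of the -1
    in the theorem.\<close>
  moreover have "((\<lambda>n. f (- int (Suc n))) has_sum (B - f 0)) UNIV"
  proof (rule norm_summable_imp_has_sum)
    show "summable (\<lambda>n. norm (f (- int (Suc n))))"
      using summable_Suc_iff[of "\<lambda>n. norm (f (- int n))"] assms(3) by simp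
    show "(\<lambda>n. f (- int (Suc n))) sums (B - f 0)"
      using sums_Suc_iff[of "\<lambda>n. f (- int n)" "B - f 0"] assms(4) by simp
  qed
  hence "(f has_sum (B - f 0)) (range (\<lambda>n. - int (Suc n)))"
    by (subst has_sum_reindex) (auto simp: o_def inj_on_def)
  ultimately have "(f has_sum (A + (B - f 0))) (range int \<union> range (\<lambda>n. - int (Suc n)))"
    by (rule has_sum_Un_disjoint) auto
  moreover have "range int \<union> range (\<lambda>n. - int (Suc n)) = UNIV"
  proof (intro equalityI subsetI UNIV_I)
    show "x \<in> range int \<union> range (\<lambda>n. - int (Suc n))" for x
      by (cases x rule: int_cases) blast+
  qed
  ultimately show ?thesis by simp
qed

text \<open>The conditions on powers of q exclude, in order, zeros of (b)_n for n >= 0, poles of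
  (a)_n for n < 0, and zeros of the denominators (az)_n and (q/(az))_n on the right.\<close>

theorem theorem2p3:
  fixes q a b z :: complex
  assumes "norm q < 1" and "norm (b / a) < norm z" and "norm z < 1"
    and "q \<noteq> 0" and "a \<noteq> 0" and "b \<noteq> 0"
    and "\<And>k::nat. b * q ^ k \<noteq> 1"
    and "\<And>k::nat. q / a * q ^ k \<noteq> 1"
    and "\<And>k::nat. a * z * q ^ k \<noteq> 1"
    and "\<And>k::nat. q / (a * z) * q ^ k \<noteq> 1"
  shows "(\<lambda>n::int. qpoch q a n / qpoch q b n * z powi n) summable_on UNIV
    \<and> summable (\<lambda>n::nat. qpoch q (a * q * z / b) (int n) * qpoch q a (int n)
          / (qpoch q q (int n) * qpoch q (a * z) (int n)) * (b / a) ^ n)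
    \<and> summable (\<lambda>n::nat. qpoch q (q / z) (int n) * qpoch q (q / b) (int n)
          / (qpoch q q (int n) * qpoch q (q / (a * z)) (int n)) * (b / a) ^ n)
    \<and> (\<Sum>\<^sub>\<infinity>n::int. qpoch q a n / qpoch q b n * z powi n) =
        - 1
        + qpoch_inf q (b / a) * qpoch_inf q (a * z) / (qpoch_inf q b * qpoch_inf q z)
          * (\<Sum>n::nat. qpoch q (a * q * z / b) (int n) * qpoch q a (int n)
              / (qpoch q q (int n) * qpoch q (a * z) (int n)) * (b / a) ^ n)
        + qpoch_inf q (b / a) * qpoch_inf q (q / (a * z))
            / (qpoch_inf q (q / a) * qpoch_inf q (b / (a * z)))
          * (\<Sum>n::nat. qpoch q (q / z) (int n) * qpoch q (q / b) (int n)
              / (qpoch q q (int n) * qpoch q (q / (a * z)) (int n)) * (b / a) ^ n)"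
proof -
  note q = assms(1,4) and a = assms(5) and b = assms(6)
  have t: "norm (b / a) < 1" using assms(2,3) by (rule less_trans)
  have z: "z \<noteq> 0" using assms(2) by auto
  \<comment> \<open>The inner radius |b/a| is exactly the convergence condition for the negative
    half.\<close>
  have z': "norm (b / (a * z)) < 1"
    using assms(2) a z by (simp add: norm_divide norm_mult field_simps)
  \<comment> \<open>The substitution (a, b, z) -> (q/b, q/a, b/(az)) fixes b/a, sends aqz/b to q/z
    and sends az to q/(az). Thus one transformation yields both series on the right.\<close>
  have t': "q / a / (q / b) = b / a" using q a b by simp
  have w': "q / b * q * (b / (a * z)) / (q / a) = q / z" using q a b z by simp
  have az': "q / b * (b / (a * z)) = q / (a * z)" using b by simp
  note H1 = Heine_q_transformation[OF q(1) assms(3) t a b assms(7,9)]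
  have T': "norm (q / a / (q / b)) < 1" unfolding t' by (rule t)
  have nz: "q / b \<noteq> 0" "q / a \<noteq> 0" using q a b by auto
  have az1': "q / b * (b / (a * z)) * q ^ k \<noteq> 1" for k
    unfolding az' by (rule assms(10))
  note H2 = Heine_q_transformation[OF q(1) z' T' nz assms(8) az1', unfolded t' w' az']
  define S1 where "S1 = qpoch_inf q (b / a) * qpoch_inf q (a * z) / (qpoch_inf q b * qpoch_inf q z)
    * (\<Sum>n. qpoch_fin q (a * q * z / b) n * qpoch_fin q a n
          / (qpoch_fin q q n * qpoch_fin q (a * z) n) * (b / a) ^ n)"
  define S2 where "S2 = qpoch_inf q (b / a) * qpoch_inf q (q / (a * z))
    / (qpoch_inf q (q / a) * qpoch_inf q (b / (a * z)))
    * (\<Sum>n. qpoch_fin q (q / z) n * qpoch_fin q (q / b) n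
          / (qpoch_fin q q n * qpoch_fin q (q / (a * z)) n) * (b / a) ^ n)"
  define f where "f n = qpoch q a n / qpoch q b n * z powi n" for n
  have f_nat: "f (int n) = qpoch_fin q a n / qpoch_fin q b n * z ^ n" for n
    by (simp add: f_def qpoch_nat[OF q(1)])
  have f_neg: "f (- int n) =
      qpoch_fin q (q / b) n / qpoch_fin q (q / a) n * (b / (a * z)) ^ n" for n
    unfolding f_def by (rule qpoch_neg_ratio[OF q a b])
  have "(f has_sum (S1 + (S2 - f 0))) UNIV"
    by (rule has_sum_int_from_halves; unfold f_nat f_neg S1_def S2_def) (fact H1 H2)+
  moreover have "f 0 = 1" using f_nat[of 0] by simp
  ultimately have sum: "(f has_sum (- 1 + S1 + S2)) UNIV" by (simp add: algebra_simps)
  show ?thesis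
    unfolding qpoch_nat[OF q(1)] f_def[symmetric] S1_def[symmetric] S2_def[symmetric]
    using has_sum_imp_summable[OF sum] infsumI[OF sum] H1(2) H2(2) by auto
qed

end
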